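(* Let $T=\begin{pmatrix} a&b\\ c&d\end{pmatrix}$ and let $S03$ be the unital associative $\mathbb{C}$-algebra generated by $a,b,c,d$ subject to the relations $R\,T_1T_2=T_2T_1R$ with $$R=R_{S0,3}=\begin{pmatrix}1&0&0&1\\0&1&1&0\\0&1&-1&0\\-1&0&0&1\end{pmatrix}.$$ Then these relations are equivalent to $$b^2+c^2=0,\ a^2-d^2=0,\ cd=ba,\ dc=-ab,\ bd=ca,\ db=-ac,\ da=ad,\ cb=-bc .$$ In terms of $\tilde a=\frac12(a+d)$, $\tilde d=\frac12(a-d)$, $\tilde b=\frac12(b+c)$, $\tilde c=\frac12(b-c)$ they are equivalent to $$\tilde b^2=\tilde c^2=0,\quad \tilde a\tilde d=\tilde d\tilde a=0,\quad \tilde a\tilde b=0,\quad \tilde b\tilde d=0,\quad \tilde d\tilde c=0,\quad \tilde c\tilde a=0 .$$ A basis of $S03$ as a vector space is given by the monomials (with $n,k_i,\ell_i\in\mathbb{Z}_{\ge 0}$) (a) $\tilde a^{k_1}\tilde c\,\tilde d^{\ell_1}\tilde b\cdots\tilde a^{k_n}\tilde c\,\tilde d^{\ell_n}\tilde b\,\tilde a^{k_{n+1}}$; (b) $\tilde d^{\ell_1}\tilde b\,\tilde a^{k_1}\tilde c\cdots\tilde d^{\ell_n}\tilde b\,\tilde a^{k_n}$; (c) $\tilde a^{k_1}\tilde c\,\tilde d^{\ell_1}\tilde b\cdots\tilde a^{k_n}\tilde c\,\tilde d^{\ell_n}$; (d) $\tilde d^{\ell_1}\tilde b\,\tilde a^{k_1}\tilde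 c\cdots\tilde d^{\ell_n}\tilde b\,\tilde a^{k_n}\tilde c\,\tilde d^{\ell_{n+1}}$, where the unit element, which occurs in the list more than once, is counted once.
   Context: $T_1=T\otimes \mathbf 1_2$ and $T_2=\mathbf 1_2\otimes T$ are $4\times4$ matrices with entries in the algebra, rows and columns indexed by pairs $11,12,21,22$: $(T_1T_2)_{ij,kl}=T_{ik}T_{jl}$ and $(T_2T_1)_{ij,kl}=T_{jl}T_{ik}$. In (b) the word ends with $\tilde b\,\tilde a^{k_n}$ and in (c) with $\tilde c\,\tilde d^{\ell_n}$; for $n=0$ the expressions (b) and (c) denote the empty word, i.e. the unit, while (a) and (d) for $n=0$ denote $\tilde a^{k_1}$ and $\tilde d^{\ell_1}$. *)

theory Defs
  imports "HOL-Analysis.Analysis" "HOL-Library.Poly_Mapping"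
begin

section \<open>Unital associative complex algebras\<close>

locale complex_algebra = vector_space scale
  for scale :: "complex \<Rightarrow> 'a::ring_1 \<Rightarrow> 'a" +
  assumes scale_mult_left: "scale z x * y = scale z (x * y)"
    and scale_mult_right: "x * scale z y = scale z (x * y)"

definition two_sided_ideal :: "'a::ring_1 set \<Rightarrow> bool" where
  "two_sided_ideal I \<longleftrightarrow> 0 \<in> I \<and> (\<forall>x\<in>I. \<forall>y\<in>I. x + y \<in> I)
     \<and> (\<forall>x\<in>I. \<forall>r. r * x \<in> I \<and> x * r \<in> I)"

lemma two_sided_ideal_Inter: "(\<And>I. I \<in> F \<Longrightarrow> two_sided_ideal I) \<Longrightarrow> two_sided_ideal (\<Inter>F)"
  unfolding two_sided_ideal_def by blast

lemma two_sided_ideal_hull: "two_sided_ideal (two_sided_ideal hull S)"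
  by (rule hull_in) (simp add: two_sided_ideal_Inter)

lemma two_sided_idealD:
  assumes "two_sided_ideal I"
  shows "0 \<in> I" "x \<in> I \<Longrightarrow> y \<in> I \<Longrightarrow> x + y \<in> I" "x \<in> I \<Longrightarrow> r * x \<in> I"
    "x \<in> I \<Longrightarrow> x * r \<in> I" "x \<in> I \<Longrightarrow> - x \<in> I" "x \<in> I \<Longrightarrow> y \<in> I \<Longrightarrow> x - y \<in> I"
proof -
  show "0 \<in> I" "x \<in> I \<Longrightarrow> x * r \<in> I"
    using assms unfolding two_sided_ideal_def by auto
  show add: "x \<in> I \<Longrightarrow> y \<in> I \<Longrightarrow> x + y \<in> I" for x y
    using assms unfolding two_sided_ideal_def by auto
  show l: "x \<in> I \<Longrightarrow> r * x \<in> I" for x r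
    using assms unfolding two_sided_ideal_def by auto
  show neg: "x \<in> I \<Longrightarrow> - x \<in> I" for x
    using l[of x "- 1"] by simp
  show "x \<in> I \<Longrightarrow> y \<in> I \<Longrightarrow> x - y \<in> I"
    using add[of x "- y"] neg[of y] by simp
qed


section \<open>The matrix relations\<close>

text \<open>Rows and columns of a \<open>4 \<times> 4\<close> matrix are indexed by pairs in the order 11, 12, 21, 22.\<close>

definition kron :: "'a::semiring_1^'n^'n \<Rightarrow> 'a^'m^'m \<Rightarrow> 'a^('n \<times> 'm)^('n \<times> 'm)" where
  "kron A B = (\<chi> p q. A $ fst p $ fst q * B $ snd p $ snd q)"

definition pair_pos :: "2 \<times> 2 \<Rightarrow> nat" where
  "pair_pos p = (if fst p = 1 then 0 else 2) + (if snd p = 1 then 0 else 1)"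

definition R_S03 :: "complex^(2 \<times> 2)^(2 \<times> 2)" where
  "R_S03 = (\<chi> p q.
     [[ 1, 0,  0, 1],
      [ 0, 1,  1, 0],
      [ 0, 1, -1, 0],
      [-1, 0,  0, 1]] ! pair_pos p ! pair_pos q)"

definition T_mat :: "'a::ring_1 \<Rightarrow> 'a \<Rightarrow> 'a \<Rightarrow> 'a \<Rightarrow> 'a^2^2" where
  "T_mat a b c d = vector [vector [a, b], vector [c, d]]"

text \<open>The two sides of \<open>R T\<^sub>1 T\<^sub>2 = T\<^sub>2 T\<^sub>1 R\<close> in an algebra with scalar multiplication \<open>sc\<close>;
  the complex matrix \<open>R\<close> is viewed as a matrix over the algebra.\<close>

definition RTT_lhs :: "(complex \<Rightarrow> 'a \<Rightarrow> 'a) \<Rightarrow> 'a::ring_1 \<Rightarrow> 'a \<Rightarrow> 'a \<Rightarrow> 'a \<Rightarrow> 'a^(2 \<times> 2)^(2 \<times> 2)" where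
  "RTT_lhs sc a b c d =
     map_matrix (\<lambda>z. sc z 1) R_S03 ** (kron (T_mat a b c d) (mat 1) ** kron (mat 1) (T_mat a b c d))"

definition RTT_rhs :: "(complex \<Rightarrow> 'a \<Rightarrow> 'a) \<Rightarrow> 'a::ring_1 \<Rightarrow> 'a \<Rightarrow> 'a \<Rightarrow> 'a \<Rightarrow> 'a^(2 \<times> 2)^(2 \<times> 2)" where
  "RTT_rhs sc a b c d =
     (kron (mat 1) (T_mat a b c d) ** kron (T_mat a b c d) (mat 1)) ** map_matrix (\<lambda>z. sc z 1) R_S03"

lemma sum_UNIV_2x2: "sum f (UNIV :: (2 \<times> 2) set) = f (1,1) + f (1,2) + f (2,1) + f (2,2)"
  unfolding UNIV_Times_UNIV[symmetric] sum.cartesian_product' sum_2 by (simp add: add.assoc)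

lemma T1_T2_nth:
  "(kron T (mat 1) ** kron (mat 1) T) $ (i, j) $ (k, l) = T $ i $ k * T $ j $ l" for T :: "'a::ring_1^2^2"
proof -
  have "\<forall>i j k l. (kron T (mat 1) ** kron (mat 1) T) $ (i, j) $ (k, l) = T $ i $ k * T $ j $ l"
    by (simp add: forall_2 matrix_matrix_mult_def kron_def mat_def sum_UNIV_2x2)
  then show ?thesis by blast
qed

lemma T2_T1_nth:
  "(kron (mat 1) T ** kron T (mat 1)) $ (i, j) $ (k, l) = T $ j $ l * T $ i $ k" for T :: "'a::ring_1^2^2"
proof -
  have "\<forall>i j k l. (kron (mat 1) T ** kron T (mat 1)) $ (i, j) $ (k, l) = T $ j $ l * T $ i $ k"
    by (simp add: forall_2 matrix_matrix_mult_def kron_def mat_def sum_UNIV_2x2)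
  then show ?thesis by blast
qed


section \<open>The free algebra on four generators\<close>

text \<open>The free monoid of words, written additively, so that the monoid algebra of HOL-Library's
  \<open>Poly_Mapping\<close> is the algebra of noncommutative polynomials.\<close>

instantiation list :: (type) monoid_add
begin
definition zero_list :: "'a list" where "zero_list = []"
definition plus_list :: "'a list \<Rightarrow> 'a list \<Rightarrow> 'a list" where "plus_list = (@)"
instance by standard (simp_all add: zero_list_def plus_list_def)
end

datatype gen = Ga | Gb | Gc | Gd

type_synonym free_alg = "gen list \<Rightarrow>\<^sub>0 complex"

definition free_gen :: "gen \<Rightarrow> free_alg" where
  "free_gen g = Poly_Mapping.single [g] 1"

definition scale_free :: "complex \<Rightarrow> free_alg \<Rightarrow> free_alg" where
  "scale_free z f = Poly_Mapping.single 0 z * f"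

lemma poly_mapping_induct [case_names single sum]:
  fixes f :: "'a \<Rightarrow>\<^sub>0 'b::monoid_add"
  assumes single: "\<And>k v. P (Poly_Mapping.single k v)" and sum: "\<And>f g. P f \<Longrightarrow> P g \<Longrightarrow> P (f + g)"
  shows "P f"
proof (induction f rule: update_induct)
  case const
  then show ?case using single[of undefined 0] by simp
next
  case (update f k v)
  have "Poly_Mapping.update k v f = f + Poly_Mapping.single k v"
    using update(1) by (intro poly_mapping_eqI)
      (auto simp: lookup_update lookup_add lookup_single when_def in_keys_iff)
  then show ?case using single sum update(3) by simp
qed

lemma single_zero_commute: "Poly_Mapping.single 0 z * f = f * Poly_Mapping.single 0 z" for f :: free_alg
proof (induction f rule: poly_mapping_induct)
  case (single k v)
  then show ?case by (simp add: mult_single mult.commute)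
next
  case (sum f g)
  then show ?case by (simp add: distrib_left distrib_right)
qed

lemma lookup_scale_free: "Poly_Mapping.lookup (scale_free z f) w = z * Poly_Mapping.lookup f w"
proof (induction f rule: poly_mapping_induct)
  case (single k v)
  then show ?case by (simp add: scale_free_def mult_single lookup_single when_def)
next
  case (sum f g)
  then show ?case by (simp add: scale_free_def distrib_left lookup_add)
qed

interpretation free_alg: complex_algebra scale_free
proof
  fix z w :: complex and f g :: free_alg
  show "scale_free z (f + g) = scale_free z f + scale_free z g"
    by (simp add: scale_free_def distrib_left)
  show "scale_free (z + w) f = scale_free z f + scale_free w f"
    by (simp add: scale_free_def single_add distrib_right)
  show "scale_free z (scale_free w f) = scale_free (z * w) f"
    by (simp add: scale_free_def mult.assoc[symmetric] mult_single)
  show "scale_free 1 f = f"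
    by (simp add: scale_free_def)
  show "scale_free z f * g = scale_free z (f * g)"
    by (simp add: scale_free_def mult.assoc)
  show "f * scale_free z g = scale_free z (f * g)"
    by (metis scale_free_def mult.assoc single_zero_commute)
qed

abbreviation rtt_relators :: "free_alg set" where "rtt_relators \<equiv> {(RTT_lhs scale_free (free_gen Ga) (free_gen Gb) (free_gen Gc) (free_gen Gd)
      - RTT_rhs scale_free (free_gen Ga) (free_gen Gb) (free_gen Gc) (free_gen Gd)) $ p $ q | p q. True}"

definition S03_ideal :: "free_alg set" where
  "S03_ideal = two_sided_ideal hull rtt_relators"

lemma S03_ideal: "two_sided_ideal S03_ideal"
  unfolding S03_ideal_def by (rule two_sided_ideal_hull)

lemma one_notin_S03_ideal: "1 \<notin> S03_ideal"
proof -
  have mult0: "Poly_Mapping.lookup (f * g) 0 = Poly_Mapping.lookup f 0 * Poly_Mapping.lookup g 0" for f g :: free_alg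
  proof (induction f rule: poly_mapping_induct)
    case (single k v)
    show ?case
    proof (induction g rule: poly_mapping_induct)
      case (single l w)
      then show ?case
        by (auto simp: mult_single lookup_single when_def zero_list_def plus_list_def)
    next
      case (sum f g)
      then show ?case by (simp add: distrib_left lookup_add)
    qed
  next
    case (sum f g)
    then show ?case by (simp add: distrib_right lookup_add)
  qed
  let ?I = "{f :: free_alg. Poly_Mapping.lookup f 0 = 0}"
  have "two_sided_ideal ?I"
    by (simp add: two_sided_ideal_def mult0 lookup_add)
  moreover have "rtt_relators \<subseteq> ?I"
  proof -
    let ?T = "T_mat (free_gen Ga) (free_gen Gb) (free_gen Gc) (free_gen Gd)"
    have "\<forall>i j. Poly_Mapping.lookup (?T $ i $ j) 0 = 0"
      by (simp add: forall_2 T_mat_def free_gen_def lookup_single zero_list_def)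
    then have "Poly_Mapping.lookup ((kron ?T (mat 1) ** kron (mat 1) ?T) $ p $ q) 0 = 0"
      "Poly_Mapping.lookup ((kron (mat 1) ?T ** kron ?T (mat 1)) $ p $ q) 0 = 0" for p q
      by (cases p; cases q; simp add: T1_T2_nth T2_T1_nth mult0)+
    then have "Poly_Mapping.lookup (RTT_lhs scale_free (free_gen Ga) (free_gen Gb) (free_gen Gc) (free_gen Gd) $ p $ q) 0 = 0"
      "Poly_Mapping.lookup (RTT_rhs scale_free (free_gen Ga) (free_gen Gb) (free_gen Gc) (free_gen Gd) $ p $ q) 0 = 0" for p q
      unfolding RTT_lhs_def RTT_rhs_def matrix_matrix_mult_def[of "map_matrix f M" for f M]
        matrix_matrix_mult_def[of _ "map_matrix f M" for f M]
      by (simp_all add: lookup_sum mult0)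
    then show ?thesis by (auto simp: lookup_minus)
  qed
  ultimately have "S03_ideal \<subseteq> ?I"
    unfolding S03_ideal_def by (rule hull_minimal[rotated])
  then show ?thesis by (auto simp: lookup_one)
qed


section \<open>The algebra S03\<close>

quotient_type S03 = free_alg / "\<lambda>f g. f - g \<in> S03_ideal"
proof (rule equivpI)
  note D = two_sided_idealD[OF S03_ideal]
  show "reflp (\<lambda>f g. f - g \<in> S03_ideal)"
    by (simp add: reflp_def D)
  show "symp (\<lambda>f g. f - g \<in> S03_ideal)"
    using D(5) by (fastforce simp: symp_def)
  show "transp (\<lambda>f g. f - g \<in> S03_ideal)"
    using D(2) by (fastforce simp: transp_def)
qed

instantiation S03 :: ring_1
begin

lift_definition zero_S03 :: S03 is 0 .
lift_definition one_S03 :: S03 is 1 .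
lift_definition plus_S03 :: "S03 \<Rightarrow> S03 \<Rightarrow> S03" is "(+)"
  using two_sided_idealD(2)[OF S03_ideal] by (fastforce simp: algebra_simps)
lift_definition minus_S03 :: "S03 \<Rightarrow> S03 \<Rightarrow> S03" is "(-)"
proof -
  fix f g h k assume "f - g \<in> S03_ideal" "h - k \<in> S03_ideal"
  from two_sided_idealD(6)[OF S03_ideal this]
  show "f - h - (g - k) \<in> S03_ideal" by (simp add: algebra_simps)
qed
lift_definition uminus_S03 :: "S03 \<Rightarrow> S03" is "uminus"
  using two_sided_idealD(5)[OF S03_ideal] by fastforce
lift_definition times_S03 :: "S03 \<Rightarrow> S03 \<Rightarrow> S03" is "(*)"
proof -
  fix f g h k assume "f - g \<in> S03_ideal" "h - k \<in> S03_ideal"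
  then have "(f - g) * h + g * (h - k) \<in> S03_ideal"
    using two_sided_idealD[OF S03_ideal] by blast
  then show "f * h - g * k \<in> S03_ideal" by (simp add: algebra_simps)
qed

instance
proof
  note 0 = two_sided_idealD(1)[OF S03_ideal]
  fix x y z :: S03
  show "x + y + z = x + (y + z)" by transfer (simp add: 0)
  show "x + y = y + x" by transfer (simp add: 0)
  show "0 + x = x" by transfer (simp add: 0)
  show "- x + x = 0" by transfer (simp add: 0)
  show "x - y = x + - y" by transfer (simp add: 0)
  show "x * y * z = x * (y * z)" by transfer (simp add: 0 mult.assoc)
  show "1 * x = x" "x * 1 = x" by (transfer, simp add: 0)+
  show "(x + y) * z = x * z + y * z" by transfer (simp add: 0 distrib_right)
  show "x * (y + z) = x * y + x * z" by transfer (simp add: 0 distrib_left)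
  show "(0::S03) \<noteq> 1"
    using one_notin_S03_ideal two_sided_idealD(5)[OF S03_ideal, of "-1"] by transfer auto
qed

end

lift_definition scale_S03 :: "complex \<Rightarrow> S03 \<Rightarrow> S03" is scale_free
  using two_sided_idealD(3)[OF S03_ideal]
  by (simp add: scale_free_def right_diff_distrib[symmetric])

interpretation S03: complex_algebra scale_S03
proof
  note 0 = two_sided_idealD(1)[OF S03_ideal]
  fix z w :: complex and x y :: S03
  show "scale_S03 z (x + y) = scale_S03 z x + scale_S03 z y"
    by transfer (simp add: 0 free_alg.scale_right_distrib)
  show "scale_S03 (z + w) x = scale_S03 z x + scale_S03 w x"
    by transfer (simp add: 0 free_alg.scale_left_distrib)
  show "scale_S03 z (scale_S03 w x) = scale_S03 (z * w) x"
    by transfer (simp add: 0)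
  show "scale_S03 1 x = x"
    by transfer (simp add: 0)
  show "scale_S03 z x * y = scale_S03 z (x * y)"
    by transfer (simp add: 0 free_alg.scale_mult_left)
  show "x * scale_S03 z y = scale_S03 z (x * y)"
    by transfer (simp add: 0 free_alg.scale_mult_right)
qed

lift_definition S03_gen :: "gen \<Rightarrow> S03" is free_gen .


section \<open>The monomials\<close>

text \<open>Labels of the families (a)--(d). The lists hold the exponent pairs, \<open>(k\<^sub>i, l\<^sub>i)\<close> in (a) and (c)
  and \<open>(l\<^sub>i, k\<^sub>i)\<close> in (b) and (d), for \<open>i = 1, \<dots>, n\<close>; in (a) and (d) the additional number is the
  final exponent \<open>k\<close> resp. \<open>l\<close> with index \<open>n + 1\<close>.\<close>

datatype label =
    Mon_a "(nat \<times> nat) list" nat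
  | Mon_b "(nat \<times> nat) list"
  | Mon_c "(nat \<times> nat) list"
  | Mon_d "(nat \<times> nat) list" nat

context
  fixes a b c d :: "'a::monoid_mult"
begin

fun word_a :: "(nat \<times> nat) list \<Rightarrow> nat \<Rightarrow> 'a" where
  "word_a [] k' = a ^ k'"
| "word_a ((k, l) # ps) k' = a ^ k * c * d ^ l * b * word_a ps k'"

fun word_b :: "(nat \<times> nat) list \<Rightarrow> 'a" where
  "word_b [] = 1"
| "word_b [(l, k)] = d ^ l * b * a ^ k"
| "word_b ((l, k) # p # ps) = d ^ l * b * a ^ k * c * word_b (p # ps)"

fun word_c :: "(nat \<times> nat) list \<Rightarrow> 'a" where
  "word_c [] = 1"
| "word_c [(k, l)] = a ^ k * c * d ^ l"
| "word_c ((k, l) # p # ps) = a ^ k * c * d ^ l * b * word_c (p # ps)"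

fun word_d :: "(nat \<times> nat) list \<Rightarrow> nat \<Rightarrow> 'a" where
  "word_d [] l' = d ^ l'"
| "word_d ((l, k) # ps) l' = d ^ l * b * a ^ k * c * word_d ps l'"

fun monomial :: "label \<Rightarrow> 'a" where
  "monomial (Mon_a ps k) = word_a ps k"
| "monomial (Mon_b ps) = word_b ps"
| "monomial (Mon_c ps) = word_c ps"
| "monomial (Mon_d ps l) = word_d ps l"

end

text \<open>The unit is the monomial of exactly four labels; only \<open>Mon_a [] 0\<close> is kept.\<close>

definition basis_labels :: "label set" where
  "basis_labels = UNIV - {Mon_b [], Mon_c [], Mon_d [] 0}"

end

theory Submission
  imports Defs
begin

text \<open>In the generators \<open>a', b', c', d'\<close> all relations are monomial, so the words without a forbidden
  pair of adjacent letters form a basis. They span because every other word vanishes. They are independent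
  because the substitution \<open>a \<mapsto> a + d, d \<mapsto> a - d, b \<mapsto> b + c, c \<mapsto> b - c\<close> of the free algebra
  maps \<open>a'\<close> to \<open>a\<close>, and so on, hence maps the ideal into the span of the forbidden words, so
  that the coefficients at the remaining words are linear functionals on S03. The two sets of letters
  that may stand at the beginning and at the end of such a word tell the four families apart.\<close>


section \<open>The relations modulo a two-sided ideal\<close>

text \<open>Here the letters stand for the tilde generators, and the left sides are the eight
  quadratic relators, up to sign, after the inverse change of generators. The right sides have the
  shape \<open>x + x\<close> to fit \<open>ideal_halve\<close>.\<close>

lemma quadratic_rels_sum_diff:
  fixes a b c d :: "'a::ring_1"
  shows "(b + c)^2 + (b - c)^2 = (b^2 + c^2) + (b^2 + c^2)"
    "(b - c) * (b + c) + (b + c) * (b - c) = (b^2 - c^2) + (b^2 - c^2)"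
    "(a + d)^2 - (a - d)^2 = (a * d + d * a) + (a * d + d * a)"
    "(a - d) * (a + d) - (a + d) * (a - d) = (a * d - d * a) + (a * d - d * a)"
    "- ((b - c) * (a - d) - (b + c) * (a + d)) = (b * d + c * a) + (b * d + c * a)"
    "- ((b + c) * (a - d) - (b - c) * (a + d)) = (b * d - c * a) + (b * d - c * a)"
    "(a - d) * (b - c) + (a + d) * (b + c) = (a * b + d * c) + (a * b + d * c)"
    "(a - d) * (b + c) + (a + d) * (b - c) = (a * b - d * c) + (a * b - d * c)"
  by (simp_all add: algebra_simps power2_eq_square)

context complex_algebra
begin

text \<open>\<open>two_sided_ideal\<close> mentions no scalars, but scaling by \<open>z\<close> is
  left multiplication by \<open>scale z 1\<close>.\<close>

lemma ideal_scale: "two_sided_ideal I \<Longrightarrow> x \<in> I \<Longrightarrow> scale z x \<in> I"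
  using two_sided_idealD(3)[of I x "scale z 1"] by (simp add: scale_mult_left)

lemma ideal_halve:
  fixes x :: 'a
  assumes "two_sided_ideal I" "x + x \<in> I"
  shows "x \<in> I"
proof -
  have "x = scale (1/2) (x + x)"
    by (simp add: scale_right_distrib scale_left_distrib[symmetric])
  then show ?thesis using ideal_scale[OF assms, of "1/2"] by simp
qed

lemma half_sum: "scale (1/2) (x + y) + scale (1/2) (x - y) = x"
  by (simp add: scale_right_distrib scale_right_diff_distrib scale_left_distrib[symmetric])

lemma half_diff: "scale (1/2) (x + y) - scale (1/2) (x - y) = y"
  by (simp add: scale_right_distrib scale_right_diff_distrib scale_left_distrib[symmetric])

definition RTT_rels :: "'a \<Rightarrow> 'a \<Rightarrow> 'a \<Rightarrow> 'a \<Rightarrow> 'a set" where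
  "RTT_rels a b c d = {(RTT_lhs scale a b c d - RTT_rhs scale a b c d) $ p $ q | p q. True}"

definition quadratic_rels :: "'a \<Rightarrow> 'a \<Rightarrow> 'a \<Rightarrow> 'a \<Rightarrow> 'a set" where
  "quadratic_rels a b c d =
     {b^2 + c^2, a^2 - d^2, c * d - b * a, d * c + a * b,
      b * d - c * a, d * b + a * c, d * a - a * d, c * b + b * c}"

definition monomial_rels :: "'a \<Rightarrow> 'a \<Rightarrow> 'a \<Rightarrow> 'a \<Rightarrow> 'a set" where
  "monomial_rels a b c d = {b^2, c^2, a * d, d * a, a * b, b * d, d * c, c * a}"

text \<open>Each of the sixteen matrix entries is, up to sign, one of the eight quadratic relators;
  four entries repeat, which leaves twelve expressions.\<close>

lemma RTT_rels_eq:
  "RTT_rels a b c d =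
     {b^2 + c^2, c * d - b * a, d * c + a * b, - (a^2 - d^2),
      d * b + a * c, - (d * a - a * d), c * b + b * c, b * d - c * a,
      - (c * b + b * c), - (d * b + a * c), - (d * c + a * b), - (b^2 + c^2)}"
proof -
  let ?M = "[[b^2 + c^2, c * d - b * a, d * c + a * b, - (a^2 - d^2)],
    [d * b + a * c, - (d * a - a * d), c * b + b * c, b * d - c * a],
    [b * d - c * a, - (c * b + b * c), - (d * a - a * d), - (d * b + a * c)],
    [- (a^2 - d^2), - (d * c + a * b), c * d - b * a, - (b^2 + c^2)]]"
  have "\<forall>i j k l. (RTT_lhs scale a b c d - RTT_rhs scale a b c d) $ (i, j) $ (k, l) =
   ?M ! pair_pos (i, j) ! pair_pos (k, l)"
    \<comment> \<open>Only the outer products with \<open>R\<close> are unfolded, so that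
      \<open>T1_T2_nth\<close> and \<open>T2_T1_nth\<close> still apply to the inner
      products.\<close>
    unfolding RTT_lhs_def RTT_rhs_def matrix_matrix_mult_def[of "map_matrix f M" for f M]
        matrix_matrix_mult_def[of _ "map_matrix f M" for f M]
    by (simp add: forall_2 sum_UNIV_2x2 T1_T2_nth T2_T1_nth T_mat_def R_S03_def pair_pos_def
      map_matrix_def power2_eq_square)
  then have "(RTT_lhs scale a b c d - RTT_rhs scale a b c d) $ p $ q = ?M ! pair_pos p ! pair_pos q" for p q
    by (cases p; cases q) blast
  then have "RTT_rels a b c d = (\<Union>p. \<Union>q. {?M ! pair_pos p ! pair_pos q})"
    unfolding RTT_rels_def by auto
  also have "\<dots> = (\<Union>i\<in>{1, 2}. \<Union>j\<in>{1, 2}. \<Union>k\<in>{1, 2}. \<Union>l\<in>{1, 2}. {?M ! pair_pos (i, j) ! pair_pos (k, l)})"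
    by (rule set_eqI) (simp only: UNIV_2[symmetric] UN_iff singleton_iff bex_UNIV split_paired_Ex)
  finally show ?thesis
    by (simp only: UN_insert UN_empty pair_pos_def fst_conv snd_conv) auto
qed

lemma RTT_rels_subset_iff:
  assumes I: "two_sided_ideal I"
  shows "RTT_rels a b c d \<subseteq> I \<longleftrightarrow> quadratic_rels a b c d \<subseteq> I"
proof -
  have "- x \<in> I \<longleftrightarrow> x \<in> I" for x
    using two_sided_idealD(5)[OF I, of x] two_sided_idealD(5)[OF I, of "- x"] by auto
  then show ?thesis
    unfolding RTT_rels_eq quadratic_rels_def by (simp only: insert_subset empty_subsetI) blast
qed

text \<open>Up to sign, the quadratic relators fall into four pairs \<open>2(u + v)\<close>,
  \<open>2(u - v)\<close> with monomial relators \<open>u\<close> and \<open>v\<close>. Since 2 is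
  invertible, an ideal contains such a pair iff it contains \<open>u\<close> and
  \<open>v\<close>.\<close>

lemma quadratic_rels_subset_iff:
  fixes a b c d
  assumes I: "two_sided_ideal I"
  defines "a' \<equiv> scale (1/2) (a + d)" and "d' \<equiv> scale (1/2) (a - d)"
    and "b' \<equiv> scale (1/2) (b + c)" and "c' \<equiv> scale (1/2) (b - c)"
  shows "quadratic_rels a b c d \<subseteq> I \<longleftrightarrow> monomial_rels a' b' c' d' \<subseteq> I"
proof -
  note add = two_sided_idealD(2)[OF I] and diff = two_sided_idealD(6)[OF I]
    and half = ideal_halve[OF I]
  have e: "a = a' + d'" "d = a' - d'" "b = b' + c'" "c = b' - c'"
    by (simp_all add: a'_def b'_def c'_def d'_def half_sum half_diff)
  let ?r1 = "b^2 + c^2" and ?r2 = "a^2 - d^2" and ?r3 = "c * d - b * a" and ?r4 = "d * c + a * b"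
    and ?r5 = "b * d - c * a" and ?r6 = "d * b + a * c" and ?r7 = "d * a - a * d" and ?r8 = "c * b + b * c"
  have q: "?r1 = (b'^2 + c'^2) + (b'^2 + c'^2)" "?r8 = (b'^2 - c'^2) + (b'^2 - c'^2)"
    "?r2 = (a' * d' + d' * a') + (a' * d' + d' * a')" "?r7 = (a' * d' - d' * a') + (a' * d' - d' * a')"
    "- ?r3 = (b' * d' + c' * a') + (b' * d' + c' * a')" "- ?r5 = (b' * d' - c' * a') + (b' * d' - c' * a')"
    "?r4 = (a' * b' + d' * c') + (a' * b' + d' * c')" "?r6 = (a' * b' - d' * c') + (a' * b' - d' * c')"
    unfolding e by (rule quadratic_rels_sum_diff)+
  have pair: "x + x \<in> I \<and> y + y \<in> I \<longleftrightarrow> u \<in> I \<and> v \<in> I" if "x = u + v" "y = u - v" for x y u v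
  proof
    assume "x + x \<in> I \<and> y + y \<in> I"
    then have "x \<in> I" "y \<in> I" using half[of x] half[of y] by auto
    \<comment> \<open>\<open>u + u = x + y\<close> and \<open>v + v = x - y\<close>.\<close>
    then have "u + u \<in> I" "v + v \<in> I"
      using add[of x y] diff[of x y] by (simp_all add: that)
    then show "u \<in> I \<and> v \<in> I" using half[of u] half[of v] by auto
  qed (use that add diff in auto)
  have neg: "x \<in> I \<longleftrightarrow> - x \<in> I" for x
    using two_sided_idealD(5)[OF I, of x] two_sided_idealD(5)[OF I, of "- x"] by auto
  have "?r1 \<in> I \<and> ?r8 \<in> I \<longleftrightarrow> b'^2 \<in> I \<and> c'^2 \<in> I"
    "?r2 \<in> I \<and> ?r7 \<in> I \<longleftrightarrow> a' * d' \<in> I \<and> d' * a' \<in> I"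
    "?r3 \<in> I \<and> ?r5 \<in> I \<longleftrightarrow> b' * d' \<in> I \<and> c' * a' \<in> I"
    "?r4 \<in> I \<and> ?r6 \<in> I \<longleftrightarrow> a' * b' \<in> I \<and> d' * c' \<in> I"
    unfolding neg[of ?r3] neg[of ?r5] q by (rule pair; simp)+
  then show ?thesis
    unfolding quadratic_rels_def monomial_rels_def insert_subset by blast
qed

lemma RTT_eq_iff: "RTT_lhs scale a b c d = RTT_rhs scale a b c d \<longleftrightarrow> RTT_rels a b c d \<subseteq> {0}"
proof
  assume "RTT_rels a b c d \<subseteq> {0}"
  then have "(RTT_lhs scale a b c d - RTT_rhs scale a b c d) $ p $ q = 0" for p q
    unfolding RTT_rels_def by blast
  then show "RTT_lhs scale a b c d = RTT_rhs scale a b c d"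
    by (simp add: vec_eq_iff)
qed (auto simp: RTT_rels_def)

text \<open>The zero ideal turns the equivalences between ideal memberships into equivalences
  between equations.\<close>

lemma two_sided_ideal_zero: "two_sided_ideal {0 :: 'a}"
  by (simp add: two_sided_ideal_def)

lemma RTT_iff_quadratic:
  "RTT_lhs scale a b c d = RTT_rhs scale a b c d \<longleftrightarrow>
     b^2 + c^2 = 0 \<and> a^2 - d^2 = 0 \<and> c * d = b * a \<and> d * c = - (a * b) \<and>
     b * d = c * a \<and> d * b = - (a * c) \<and> d * a = a * d \<and> c * b = - (b * c)"
  unfolding RTT_eq_iff RTT_rels_subset_iff[OF two_sided_ideal_zero] quadratic_rels_def
  by (simp add: eq_neg_iff_add_eq_0)

lemma RTT_iff_monomial:
  fixes a b c d
  defines "a' \<equiv> scale (1/2) (a + d)" and "d' \<equiv> scale (1/2) (a - d)"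
    and "b' \<equiv> scale (1/2) (b + c)" and "c' \<equiv> scale (1/2) (b - c)"
  shows "RTT_lhs scale a b c d = RTT_rhs scale a b c d \<longleftrightarrow>
     b'^2 = 0 \<and> c'^2 = 0 \<and> a' * d' = 0 \<and> d' * a' = 0 \<and>
     a' * b' = 0 \<and> b' * d' = 0 \<and> d' * c' = 0 \<and> c' * a' = 0"
  unfolding RTT_eq_iff RTT_rels_subset_iff[OF two_sided_ideal_zero]
    quadratic_rels_subset_iff[OF two_sided_ideal_zero] monomial_rels_def assms
  by auto

end

text \<open>A hull is the intersection of the ideals containing the set, so it depends only on which
  ideals these are.\<close>

lemma two_sided_ideal_hull_cong:
  assumes "\<And>I. two_sided_ideal I \<Longrightarrow> S \<subseteq> I \<longleftrightarrow> S' \<subseteq> I"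
  shows "two_sided_ideal hull S = two_sided_ideal hull S'"
  unfolding hull_def using assms by (metis (mono_tags, lifting))

lemma S03_ideal_quadratic:
  "S03_ideal = two_sided_ideal hull
     free_alg.quadratic_rels (free_gen Ga) (free_gen Gb) (free_gen Gc) (free_gen Gd)"
  unfolding S03_ideal_def
  using free_alg.RTT_rels_subset_iff
  by (intro two_sided_ideal_hull_cong) (simp add: free_alg.RTT_rels_def)

text \<open>Scalar multiplication and generators are parameters so that one formula serves both the
  free algebra and \<open>S03\<close>.\<close>

fun tilde :: "(complex \<Rightarrow> 'r \<Rightarrow> 'r) \<Rightarrow> (gen \<Rightarrow> 'r::ring_1) \<Rightarrow> gen \<Rightarrow> 'r" where
  "tilde sc g Ga = sc (1/2) (g Ga + g Gd)"
| "tilde sc g Gb = sc (1/2) (g Gb + g Gc)"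
| "tilde sc g Gc = sc (1/2) (g Gb - g Gc)"
| "tilde sc g Gd = sc (1/2) (g Ga - g Gd)"

text \<open>The inverse change of generators. It recovers the generators from the tilde generators
  and, as a substitution, sends each tilde generator to a plain letter.\<close>

fun untilde :: "(gen \<Rightarrow> 'r::ring_1) \<Rightarrow> gen \<Rightarrow> 'r" where
  "untilde g Ga = g Ga + g Gd"
| "untilde g Gb = g Gb + g Gc"
| "untilde g Gc = g Gb - g Gc"
| "untilde g Gd = g Ga - g Gd"

lemma (in complex_algebra) untilde_tilde: "untilde (tilde scale g) x = g x"
  by (cases x) (simp_all add: half_sum half_diff)

lemma S03_ideal_monomial:
  "S03_ideal = two_sided_ideal hull
     free_alg.monomial_rels (tilde scale_free free_gen Ga) (tilde scale_free free_gen Gb)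
       (tilde scale_free free_gen Gc) (tilde scale_free free_gen Gd)"
  unfolding S03_ideal_quadratic tilde.simps
  by (intro two_sided_ideal_hull_cong free_alg.quadratic_rels_subset_iff)


section \<open>Normal words\<close>

text \<open>The excluded pairs are exactly the eight monomial relators: after \<open>a\<close> or
  \<open>b\<close> only \<open>a\<close> or \<open>c\<close> may stand, after \<open>c\<close> or
  \<open>d\<close> only \<open>b\<close> or \<open>d\<close>.\<close>

definition may_follow :: "gen \<Rightarrow> gen \<Rightarrow> bool" where
  "may_follow x y \<longleftrightarrow> (x \<in> {Ga, Gb} \<longleftrightarrow> y \<in> {Ga, Gc})"

abbreviation normal_word :: "gen list \<Rightarrow> bool" where
  "normal_word \<equiv> successively may_follow"

text \<open>The functions of the two remaining families arise from these by exchanging \<open>x\<close> with \<open>t\<close>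
  and \<open>y\<close> with \<open>z\<close>.\<close>

context
  fixes x y z t :: 'g
begin

fun letters_a :: "(nat \<times> nat) list \<Rightarrow> nat \<Rightarrow> 'g list" where
  "letters_a [] k' = replicate k' x"
| "letters_a ((k, l) # ps) k' = replicate k x @ z # replicate l t @ y # letters_a ps k'"

fun letters_c :: "(nat \<times> nat) list \<Rightarrow> 'g list" where
  "letters_c [] = []"
| "letters_c [(k, l)] = replicate k x @ z # replicate l t"
| "letters_c ((k, l) # p # ps) = replicate k x @ z # replicate l t @ y # letters_c (p # ps)"

text \<open>This reduces injectivity and admissibility for the lists \<open>letters_c\<close> to the
  case of \<open>letters_a\<close>.\<close>

lemma letters_c_snoc: "ps \<noteq> [] \<Longrightarrow> letters_c ps @ [y] = letters_a ps 0"
  by (induction ps rule: letters_c.induct) auto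

lemma prod_list_replicate: "prod_list (map f (replicate k u)) = (f u :: 'm::monoid_mult) ^ k"
  by (induction k) simp_all

lemma prod_list_letters_a:
  fixes f :: "'g \<Rightarrow> 'm::monoid_mult"
  shows "prod_list (map f (letters_a ps k)) = word_a (f x) (f y) (f z) (f t) ps k"
  by (induction ps k rule: letters_a.induct) (simp_all add: prod_list_replicate mult.assoc del: map_replicate)

lemma prod_list_letters_c:
  fixes f :: "'g \<Rightarrow> 'm::monoid_mult"
  shows "prod_list (map f (letters_c ps)) = word_c (f x) (f y) (f z) (f t) ps"
  by (induction ps rule: letters_c.induct) (simp_all add: prod_list_replicate mult.assoc del: map_replicate)

section \<open>Unique readability of the letter lists\<close>

lemma replicate_append_eq:
  assumes "replicate k u @ v # r = replicate k' u @ v # r'" "u \<noteq> v"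
  shows "k = k' \<and> r = r'"
  using assms
proof (induction k arbitrary: k')
  case 0 then show ?case by (cases k') auto
next
  case (Suc k) then show ?case by (cases k') auto
qed

text \<open>The word is decoded block by block: an occurrence of \<open>z\<close> shows that a block
  remains, and \<open>z\<close> and \<open>y\<close> mark the ends of the runs of \<open>x\<close>
  and of \<open>t\<close>.\<close>

lemma letters_a_inj:
  assumes "x \<noteq> z" "t \<noteq> y"
  shows "letters_a ps k = letters_a qs l \<Longrightarrow> ps = qs \<and> k = l"
proof (induction ps arbitrary: qs)
  case Nil
  have "z \<notin> set (letters_a [] k)" using assms by simp
  with Nil obtain "qs = []" by (cases qs) auto
  with Nil show ?case by (metis letters_a.simps(1) length_replicate)
next
  case (Cons p ps)
  obtain m n where p: "p = (m, n)" by force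
  have "z \<in> set (letters_a (p # ps) k)" by (simp add: p)
  moreover have "z \<notin> set (letters_a [] l)" using assms by simp
  ultimately have "qs \<noteq> []" using Cons.prems by metis
  then obtain m' n' qs' where q: "qs = (m', n') # qs'" by (metis list.exhaust surj_pair)
  from Cons.prems have "m = m' \<and> replicate n t @ y # letters_a ps k = replicate n' t @ y # letters_a qs' l"
    by (intro replicate_append_eq[OF _ assms(1)]) (simp only: p q letters_a.simps)
  then have "m = m'" "n = n' \<and> letters_a ps k = letters_a qs' l"
    using replicate_append_eq[OF _ assms(2)] by blast+
  with Cons.IH \<open>m = m'\<close> show ?case by (auto simp: p q)
qed

lemma letters_c_eq_Nil [simp]: "letters_c ps = [] \<longleftrightarrow> ps = []"
  by (cases ps rule: letters_c.cases) auto

lemma letters_c_inj: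
  assumes "x \<noteq> z" "t \<noteq> y" "letters_c ps = letters_c qs"
  shows "ps = qs"
proof (cases "ps = []")
  case True
  then show ?thesis using assms(3) by (metis letters_c_eq_Nil)
next
  case False
  then have "qs \<noteq> []" using assms(3) by (metis letters_c_eq_Nil)
  have "letters_a ps 0 = letters_a qs 0"
    using letters_c_snoc[OF False] letters_c_snoc[OF \<open>qs \<noteq> []\<close>] assms(3) by simp
  then show ?thesis using letters_a_inj[OF assms(1,2)] by blast
qed

lemma hd_letters_a: "letters_a ps k \<noteq> [] \<Longrightarrow> hd (letters_a ps k) \<in> {x, z}"
  by (cases "(ps, k)" rule: letters_a.cases) (auto simp: hd_append hd_replicate)

lemma last_letters_a: "letters_a ps k \<noteq> [] \<Longrightarrow> last (letters_a ps k) \<in> {x, y}"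
  by (induction ps k rule: letters_a.induct) (auto simp: last_append last_replicate)

lemma hd_letters_c: "ps \<noteq> [] \<Longrightarrow> hd (letters_c ps) \<in> {x, z}"
  by (cases ps rule: letters_c.cases) (auto simp: hd_append hd_replicate)

lemma last_letters_c: "ps \<noteq> [] \<Longrightarrow> last (letters_c ps) \<in> {t, z}"
  by (induction ps rule: letters_c.induct) (auto simp: last_append last_replicate)

section \<open>Adjacent letters in the letter lists\<close>

lemma successively_replicate:
  "P u u \<Longrightarrow> successively P (replicate k u)"
proof (induction k)
  case (Suc k) then show ?case by (cases k) simp_all
qed simp

text \<open>Exchanging \<open>x\<close> with \<open>t\<close> and \<open>y\<close> with
  \<open>z\<close> permutes the eight assumptions on \<open>P\<close>, so the results cover all four
  families.\<close>

context
  fixes P :: "'g \<Rightarrow> 'g \<Rightarrow> bool"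
  assumes P: "P x x" "P x z" "P z t" "P z y" "P t t" "P t y" "P y x" "P y z"
begin

lemma successively_letters_a: "successively P (letters_a ps k)"
proof (induction ps k rule: letters_a.induct)
  case (2 k l ps k')
  have "letters_a ps k' = [] \<or> P y (hd (letters_a ps k'))"
    using hd_letters_a[of ps k'] P by (metis insert_iff singletonD)
  with 2 show ?case using P
    by (cases "k = 0"; cases "l = 0") (auto simp: successively_append_iff successively_Cons
        successively_replicate hd_append)
qed (simp add: successively_replicate P)

lemma successively_letters_c: "successively P (letters_c ps)"
proof (cases "ps = []")
  case False
  then have "successively P (letters_c ps @ [y])"
    by (simp add: letters_c_snoc successively_letters_a)
  then show ?thesis by (simp add: successively_append_iff)
qed simp

end

section \<open>Every admissible word is a letter list\<close>

lemma split_replicate: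
  obtains k r where "w = replicate k u @ r" "r = [] \<or> hd r \<noteq> u"
proof
  have "set (takeWhile ((=) u) w) \<subseteq> {u}" by (auto dest: set_takeWhileD)
  then show "w = replicate (length (takeWhile ((=) u) w)) u @ dropWhile ((=) u) w"
    by (metis replicate_length_same singletonD subsetD takeWhile_dropWhile_id)
  show "dropWhile ((=) u) w = [] \<or> hd (dropWhile ((=) u) w) \<noteq> u"
    using hd_dropWhile[of "(=) u" w] by metis
qed

text \<open>Induction on the length: strip the maximal run of \<open>x\<close>, a letter
  \<open>z\<close>, the maximal run of \<open>t\<close> and a letter \<open>y\<close>; the rest
  again starts with \<open>x\<close> or \<open>z\<close>. A word ending in the run of
  \<open>x\<close> is of the first kind, one ending in the run of \<open>t\<close> of the
  second.\<close>

lemma letters_exhaust: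
  assumes "\<And>u v. P u v \<longleftrightarrow> (u \<in> {x, y} \<longleftrightarrow> v \<in> {x, z})" "\<And>u. u \<in> {x, y, z, t}" "distinct [x, y, z, t]"
    and "successively P w" "w = [] \<or> hd w \<in> {x, z}"
  shows "(\<exists>ps k. w = letters_a ps k) \<or> (\<exists>ps. w = letters_c ps)"
  using assms(4,5)
proof (induction w rule: length_induct)
  case (1 w)
  obtain k r where w: "w = replicate k x @ r" and r: "r = [] \<or> hd r \<noteq> x"
    by (rule split_replicate)
  have r': "successively P r" using 1(2) by (simp add: w successively_append_iff)
  show ?case
  proof (cases r)
    case Nil
    then have "w = letters_a [] k" by (simp add: w)
    then show ?thesis by blast
  next
    case (Cons u s)
    \<comment> \<open>At the start of the word the assumption on \<open>hd w\<close> leaves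
      \<open>x\<close> or \<open>z\<close>, after an \<open>x\<close> the relation \<open>P\<close>
      does; maximality of the run excludes \<open>x\<close>.\<close>
    have "u = z"
    proof (cases k)
      case 0
      with 1(3) r Cons w show ?thesis by auto
    next
      case (Suc m)
      then have "replicate k x \<noteq> []" "last (replicate k x) = x" by auto
      then have "P x u" using 1(2) unfolding w Cons successively_append_iff by auto
      with r Cons assms(1) show ?thesis by auto
    qed
    obtain l q where s: "s = replicate l t @ q" and q: "q = [] \<or> hd q \<noteq> t"
      by (rule split_replicate)
    have w': "w = replicate k x @ z # replicate l t @ q" by (simp add: w Cons \<open>u = z\<close> s)
    show ?thesis
    proof (cases q)
      case Nil
      then have "w = letters_c [(k, l)]" by (simp add: w')
      then show ?thesis by blast
    next
      case (Cons v q')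
      \<comment> \<open>The preceding letter is \<open>z\<close> or \<open>t\<close>, so
        \<open>v\<close> is neither \<open>x\<close> nor \<open>z\<close>; it is not
        \<open>t\<close> by maximality of the run, which leaves \<open>y\<close>.\<close>
      have "P (last (z # replicate l t)) v"
        using 1(2) unfolding w' Cons by (auto simp: successively_append_iff successively_Cons hd_append)
      then have "v \<notin> {x, z}" using assms(1,3) by (auto simp: last_replicate split: if_splits)
      with assms(2)[of v] q Cons have "v = y" by auto
      have "successively P q'" "q' = [] \<or> P y (hd q')"
        using 1(2) unfolding w' Cons \<open>v = y\<close> by (auto simp: successively_append_iff successively_Cons)
      then have "(\<exists>ps k. q' = letters_a ps k) \<or> (\<exists>ps. q' = letters_c ps)"
        using 1(1)[rule_format, of q'] assms(1)[of y "hd q'"] by (auto simp: w' Cons)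
      then show ?thesis
      proof (elim disjE exE)
        fix ps j assume "q' = letters_a ps j"
        then have "w = letters_a ((k, l) # ps) j" by (simp add: w' Cons \<open>v = y\<close>)
        then show ?thesis by blast
      next
        fix ps assume q': "q' = letters_c ps"
        show ?thesis
        proof (cases ps)
          case Nil
          \<comment> \<open>With nothing after \<open>y\<close>, prepending the block to the empty
            \<open>letters_c\<close> list would lose this \<open>y\<close>; the word is of the first
            kind with final exponent 0.\<close>
          then have "w = letters_a [(k, l)] 0" by (simp add: w' Cons \<open>v = y\<close> q')
          then show ?thesis by blast
        next
          case (Cons p ps')
          then have "w = letters_c ((k, l) # ps)" by (simp add: w' \<open>q = v # q'\<close> \<open>v = y\<close> q')
          then show ?thesis by blast
        qed
      qed
    qed
  qed
qed

end

section \<open>The four families as normal words\<close>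

lemma word_d_eq: "word_d a b c d ps l = word_a d c b a ps l"
  by (induction ps l rule: word_d.induct) simp_all

lemma word_b_eq: "word_b a b c d ps = word_c d c b a ps"
  by (induction ps rule: word_b.induct) simp_all

fun letters :: "label \<Rightarrow> gen list" where
  "letters (Mon_a ps k) = letters_a Ga Gb Gc Gd ps k"
| "letters (Mon_b ps) = letters_c Gd Gc Gb Ga ps"
| "letters (Mon_c ps) = letters_c Ga Gb Gc Gd ps"
| "letters (Mon_d ps l) = letters_a Gd Gc Gb Ga ps l"

lemma prod_list_letters:
  "prod_list (map f (letters L)) = monomial (f Ga) (f Gb) (f Gc) (f Gd) L"
  by (cases L) (simp_all add: prod_list_letters_a prod_list_letters_c word_d_eq word_b_eq)

lemma normal_word_letters: "normal_word (letters L)"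
  by (cases L) (auto intro!: successively_letters_a successively_letters_c simp: may_follow_def)

lemma normal_word_imp_letters:
  assumes "normal_word w"
  obtains L where "w = letters L"
proof (cases "w = [] \<or> hd w \<in> {Ga, Gc}")
  case True
  have "(\<exists>ps k. w = letters_a Ga Gb Gc Gd ps k) \<or> (\<exists>ps. w = letters_c Ga Gb Gc Gd ps)"
    using gen.exhaust assms True by (intro letters_exhaust[where P = may_follow]) (auto simp: may_follow_def)
  then show ?thesis using that letters.simps(1,3) by metis
next
  case False
  have u: "u \<in> {Gd, Gc, Gb, Ga}" for u by (cases u) auto
  \<comment> \<open>Negating both sides of the equivalence in \<open>may_follow\<close> exchanges
    \<open>Ga\<close> with \<open>Gd\<close> and \<open>Gb\<close> with \<open>Gc\<close>.\<close>
  have "may_follow u v \<longleftrightarrow> (u \<in> {Gd, Gc} \<longleftrightarrow> v \<in> {Gd, Gb})" for u v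
    by (cases u; cases v) (auto simp: may_follow_def)
  then have "(\<exists>ps k. w = letters_a Gd Gc Gb Ga ps k) \<or> (\<exists>ps. w = letters_c Gd Gc Gb Ga ps)"
    using u[of "hd w"] assms False u by (intro letters_exhaust[where P = may_follow]) auto
  then show ?thesis using that letters.simps(2,4) by metis
qed

lemma range_letters: "range letters = Collect normal_word"
  using normal_word_letters normal_word_imp_letters by (auto simp: image_iff) metis

text \<open>Each of the three removed labels spells the empty word, which \<open>Mon_a [] 0\<close>
  still represents.\<close>

lemma letters_basis_labels: "letters ` basis_labels = Collect normal_word"
proof -
  have "letters L \<in> letters ` basis_labels" for L
  proof (cases "L \<in> basis_labels")
    case False
    then have "letters L = letters (Mon_a [] 0)" by (auto simp: basis_labels_def)
    moreover have "Mon_a [] 0 \<in> basis_labels" by (simp add: basis_labels_def)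
    ultimately show ?thesis by (metis imageI)
  qed simp
  then show ?thesis unfolding range_letters[symmetric] by auto
qed

lemma inj_on_letters: "inj_on letters basis_labels"
proof -
  have nil: "L = Mon_a [] 0" if "L \<in> basis_labels" "letters L = []" for L
    using that
  proof (cases L)
    case (Mon_a ps k)
    with that show ?thesis by (cases ps) auto
  next
    case (Mon_d ps k)
    with that show ?thesis by (cases ps) (auto simp: basis_labels_def)
  qed (auto simp: basis_labels_def)
  \<comment> \<open>Two disjoint classes of first letters and two of last letters give four
    combinations, one for each constructor. Within one constructor unique readability suffices; the
    empty word has no end letters and was treated separately.\<close>
  have ends: "hd (letters L) \<in> (case L of Mon_a _ _ \<Rightarrow> {Ga, Gc} | Mon_c _ \<Rightarrow> {Ga, Gc} | _ \<Rightarrow> {Gd, Gb}) \<and>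
     last (letters L) \<in> (case L of Mon_a _ _ \<Rightarrow> {Ga, Gb} | Mon_b _ \<Rightarrow> {Ga, Gb} | _ \<Rightarrow> {Gd, Gc})"
    if "letters L \<noteq> []" for L
  proof (cases L)
    case (Mon_a ps k)
    then show ?thesis
      using that hd_letters_a[of Ga Gb Gc Gd ps k] last_letters_a[of Ga Gb Gc Gd ps k] by auto
  next
    case (Mon_b ps)
    then show ?thesis
      using that hd_letters_c[of ps Gd Gc Gb Ga] last_letters_c[of ps Gd Gc Gb Ga] by auto
  next
    case (Mon_c ps)
    then show ?thesis
      using that hd_letters_c[of ps Ga Gb Gc Gd] last_letters_c[of ps Ga Gb Gc Gd] by auto
  next
    case (Mon_d ps k)
    then show ?thesis
      using that hd_letters_a[of Gd Gc Gb Ga ps k] last_letters_a[of Gd Gc Gb Ga ps k] by auto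
  qed
  show ?thesis
  proof (rule inj_onI)
    fix L M assume LM: "L \<in> basis_labels" "M \<in> basis_labels" "letters L = letters M"
    show "L = M"
    proof (cases "letters L = []")
      case True
      then show ?thesis using nil LM by metis
    next
      case False
      then show ?thesis
        using ends[of L] ends[of M] LM(3)
        by (cases L; cases M) (auto dest: letters_a_inj[rotated 2] letters_c_inj[rotated 2])
    qed
  qed
qed


section \<open>Substitution in the free algebra\<close>

context complex_algebra
begin

text \<open>The algebra homomorphism given by the universal property of the free algebra.\<close>

definition subst :: "(gen \<Rightarrow> 'a) \<Rightarrow> free_alg \<Rightarrow> 'a" where
  "subst g f = (\<Sum>w\<in>Poly_Mapping.keys f. scale (Poly_Mapping.lookup f w) (prod_list (map g w)))"

text \<open>Sums over the keys of different polynomials can thus be taken over one common index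
  set.\<close>

lemma subst_superset:
  assumes "finite A" "Poly_Mapping.keys f \<subseteq> A"
  shows "subst g f = (\<Sum>w\<in>A. scale (Poly_Mapping.lookup f w) (prod_list (map g w)))"
  unfolding subst_def using assms by (intro sum.mono_neutral_left) (auto simp: in_keys_iff)

lemma subst_add: "subst g (f + h) = subst g f + subst g h"
proof -
  let ?A = "Poly_Mapping.keys f \<union> Poly_Mapping.keys h"
  have "Poly_Mapping.keys (f + h) \<subseteq> ?A" by (rule Poly_Mapping.keys_add)
  then show ?thesis
    by (simp add: subst_superset[of ?A] lookup_add scale_left_distrib sum.distrib)
qed

lemma subst_single: "subst g (Poly_Mapping.single w z) = scale z (prod_list (map g w))"
  by (simp add: subst_superset[of "{w}"])

lemma subst_mult: "subst g (f * h) = subst g f * subst g h"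
proof (induction f rule: poly_mapping_induct)
  case (single v z)
  show ?case
  proof (induction h rule: poly_mapping_induct)
    case (single w y)
    then show ?case
      by (simp add: mult_single subst_single plus_list_def scale_mult_left scale_mult_right mult.commute)
  next
    case (sum h k)
    then show ?case by (simp add: distrib_left subst_add)
  qed
next
  case (sum f k)
  then show ?case by (simp add: distrib_right subst_add)
qed

lemma subst_scale: "subst g (scale_free z f) = scale z (subst g f)"
  by (simp add: scale_free_def subst_mult subst_single zero_list_def scale_mult_left)

lemma subst_zero: "subst g 0 = 0"
  by (simp add: subst_def)

lemma subst_one: "subst g 1 = 1"
  using subst_single[of g 0 1] unfolding single_one by (simp add: zero_list_def)

lemma subst_minus: "subst g (f - h) = subst g f - subst g h"
  using subst_add[of g "f - h" h] by simp

lemma subst_gen: "subst g (free_gen x) = g x"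
  by (simp add: free_gen_def subst_single)

lemma subst_prod_list: "subst g (prod_list (map f w)) = prod_list (map (\<lambda>x. subst g (f x)) w)"
  by (induction w) (simp_all add: subst_one subst_mult)

lemma subst_untilde_tilde: "subst (untilde g) (tilde scale_free free_gen x) = g x"
  using half_sum half_diff
  by (cases x) (simp_all add: subst_scale subst_add subst_minus subst_gen scale_left_distrib[symmetric] scale_right_distrib)

end

lemma prod_list_free_gen: "prod_list (map free_gen w) = Poly_Mapping.single w 1"
  by (induction w) (simp_all add: free_gen_def mult_single plus_list_def zero_list_def flip: single_one)

lemma normal_word_append: "normal_word (v + w) \<Longrightarrow> normal_word v \<and> normal_word w"
  by (simp add: plus_list_def successively_append_iff)

text \<open>Factors of a normal word are normal, so a word with a forbidden factor stays forbidden
  under multiplication on either side.\<close>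

lemma ideal_no_normal_word:
  "two_sided_ideal {f :: free_alg. \<forall>w\<in>Poly_Mapping.keys f. \<not> normal_word w}" (is "two_sided_ideal ?I")
proof -
  have "f + g \<in> ?I" if "f \<in> ?I" "g \<in> ?I" for f g
    using that Poly_Mapping.keys_add[of f g] by blast
  moreover have "r * f \<in> ?I" "f * r \<in> ?I" if "f \<in> ?I" for f r
    using that keys_mult[of f r] keys_mult[of r f] normal_word_append by blast+
  moreover have "0 \<in> ?I" by simp
  ultimately show ?thesis unfolding two_sided_ideal_def by blast
qed

lemma ideal_vimage:
  assumes "two_sided_ideal I" "h 0 = 0" "\<And>x y. h (x + y) = h x + h y" "\<And>x y. h (x * y) = h x * h y"
  shows "two_sided_ideal (h -` I)"
  using assms unfolding two_sided_ideal_def by simp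

text \<open>By minimality of the hull only the eight monomial relators need checking; the
  substitution turns each of them into a forbidden word of two letters.\<close>

lemma lookup_subst_S03_ideal:
  assumes "f \<in> S03_ideal" "normal_word w"
  shows "Poly_Mapping.lookup (free_alg.subst (untilde free_gen) f) w = 0"
proof -
  define I :: "free_alg set" where "I = {f. \<forall>w\<in>Poly_Mapping.keys f. \<not> normal_word w}"
  have "two_sided_ideal (free_alg.subst (untilde free_gen) -` I)"
    using ideal_no_normal_word unfolding I_def[symmetric]
    by (rule ideal_vimage) (simp_all add: free_alg.subst_zero free_alg.subst_add free_alg.subst_mult)
  moreover have I: "free_gen x * free_gen y \<in> I" if "\<not> may_follow x y" for x y
    using that by (simp add: I_def free_gen_def mult_single plus_list_def)
  have "free_alg.monomial_rels (tilde scale_free free_gen Ga) (tilde scale_free free_gen Gb)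
       (tilde scale_free free_gen Gc) (tilde scale_free free_gen Gd) \<subseteq> free_alg.subst (untilde free_gen) -` I"
    unfolding free_alg.monomial_rels_def power2_eq_square
    by (simp add: free_alg.subst_mult free_alg.subst_untilde_tilde I may_follow_def del: tilde.simps)
  ultimately have "S03_ideal \<subseteq> free_alg.subst (untilde free_gen) -` I"
    unfolding S03_ideal_monomial by (rule hull_minimal[rotated])
  then have "free_alg.subst (untilde free_gen) f \<in> I" using assms(1) by blast
  then have "w \<notin> Poly_Mapping.keys (free_alg.subst (untilde free_gen) f)"
    using assms(2) by (auto simp only: I_def mem_Collect_eq)
  then show ?thesis by (simp only: in_keys_iff not_not)
qed


section \<open>The basis of S03\<close>

text \<open>Only the coefficients at normal words are independent of the representative; at all
  other words 0 is a default value.\<close>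

lift_definition normal_coeff :: "S03 \<Rightarrow> gen list \<Rightarrow> complex" is
  "\<lambda>f w. if normal_word w then Poly_Mapping.lookup (free_alg.subst (untilde free_gen) f) w else 0"
  using lookup_subst_S03_ideal by (fastforce simp: free_alg.subst_minus lookup_minus)

lemma normal_coeff_zero: "normal_coeff 0 w = 0"
  by transfer (simp add: free_alg.subst_zero)

lemma normal_coeff_add: "normal_coeff (f + g) w = normal_coeff f w + normal_coeff g w"
  by transfer (simp add: free_alg.subst_add lookup_add)

lemma normal_coeff_scale: "normal_coeff (scale_S03 z f) w = z * normal_coeff f w"
  by transfer (simp add: free_alg.subst_scale lookup_scale_free)

lemma normal_coeff_sum: "normal_coeff (\<Sum>x\<in>A. F x) w = (\<Sum>x\<in>A. normal_coeff (F x) w)"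
  by (induction A rule: infinite_finite_induct) (simp_all add: normal_coeff_zero normal_coeff_add)

definition S03_word :: "gen list \<Rightarrow> S03" where
  "S03_word w = prod_list (map (tilde scale_S03 S03_gen) w)"

text \<open>An explicit representative in the free algebra, on which \<open>normal_coeff\<close> can
  be evaluated.\<close>

lemma S03_word_eq: "S03_word w = abs_S03 (prod_list (map (tilde scale_free free_gen) w))"
proof -
  have "tilde scale_S03 S03_gen x = abs_S03 (tilde scale_free free_gen x)" for x
    by (cases x) (simp_all add: S03_gen.abs_eq S03_gen_def plus_S03.abs_eq minus_S03.abs_eq scale_S03.abs_eq)
  then show ?thesis unfolding S03_word_def
    by (induction w) (simp_all add: one_S03.abs_eq one_S03_def times_S03.abs_eq del: tilde.simps)
qed

text \<open>The substitution sends the representative of \<open>S03_word w\<close> to the single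
  word \<open>w\<close>, so the coefficients at normal words form a dual family.\<close>

lemma normal_coeff_word:
  "normal_word v \<Longrightarrow> normal_coeff (S03_word w) v = (if v = w then 1 else 0)"
  unfolding S03_word_eq
  by (simp add: normal_coeff.abs_eq free_alg.subst_prod_list free_alg.subst_untilde_tilde
      prod_list_free_gen lookup_single when_def)

section \<open>Linear independence of the normal monomials\<close>

lemma inj_on_S03_word: "inj_on S03_word (Collect normal_word)"
proof (rule inj_onI)
  fix v w assume "v \<in> Collect normal_word" "w \<in> Collect normal_word" "S03_word v = S03_word w"
  then show "v = w"
    using normal_coeff_word[of v v] normal_coeff_word[of v w] by (auto split: if_splits)
qed

lemma independent_S03_word: "S03.independent (S03_word ` Collect normal_word)"
  unfolding S03.independent_explicit_finite_subsets
proof (intro allI impI ballI)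
  fix S u s
  assume S: "S \<subseteq> S03_word ` Collect normal_word" "finite S"
    and 0: "(\<Sum>v\<in>S. scale_S03 (u v) v) = 0" and s: "s \<in> S"
  obtain w where w: "normal_word w" "s = S03_word w" using S s by auto
  \<comment> \<open>The coefficient functional at \<open>w\<close> annihilates every summand except
    the one at \<open>s\<close>.\<close>
  have "0 = normal_coeff (\<Sum>v\<in>S. scale_S03 (u v) v) w"
    by (simp add: 0 normal_coeff_zero)
  also have "\<dots> = (\<Sum>v\<in>S. u v * normal_coeff v w)"
    by (simp add: normal_coeff_sum normal_coeff_scale)
  also have "\<dots> = (\<Sum>v\<in>S. if v = s then u v else 0)"
  proof (rule sum.cong)
    fix v assume "v \<in> S"
    then obtain w' where "v = S03_word w'" using S by auto
    then show "u v * normal_coeff v w = (if v = s then u v else 0)"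
      using w normal_coeff_word[OF w(1), of w'] normal_coeff_word[OF w(1), of w] by auto
  qed simp
  also have "\<dots> = u s" using S s by simp
  finally show "u s = 0" by simp
qed

section \<open>Spanning by the normal monomials\<close>

lemma S03_word_zero:
  assumes "\<not> normal_word w"
  shows "S03_word w = 0"
proof -
  have rel: "tilde scale_S03 S03_gen x * tilde scale_S03 S03_gen y = 0" if "\<not> may_follow x y" for x y
  proof -
    \<comment> \<open>A pair violating \<open>may_follow\<close> is one of the generators of the
      ideal.\<close>
    have "tilde scale_free free_gen x * tilde scale_free free_gen y \<in> S03_ideal"
      unfolding S03_ideal_monomial free_alg.monomial_rels_def power2_eq_square
      by (rule hull_inc) (use that in \<open>cases x; cases y; simp add: may_follow_def del: tilde.simps\<close>)
    then have "S03_word [x, y] = 0"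
      unfolding S03_word_eq zero_S03_def by (simp add: S03.abs_eq_iff del: tilde.simps)
    then show ?thesis by (simp add: S03_word_def)
  qed
  show ?thesis using assms
  proof (induction w)
    case (Cons x w)
    show ?case
    proof (cases "normal_word w")
      case True
      \<comment> \<open>With a normal tail, the forbidden pair must stand at the front.\<close>
      with Cons.prems obtain y v where "w = y # v" "\<not> may_follow x y"
        by (cases w) auto
      then show ?thesis
        using rel by (simp add: S03_word_def mult.assoc[symmetric] del: tilde.simps)
    qed (use Cons.IH in \<open>simp add: S03_word_def\<close>)
  qed simp
qed

text \<open>The span contains 1 and is closed under left multiplication by the tilde generators,
  hence also by the original generators, which are sums and differences of them. So it contains all
  words in the original generators.\<close>

lemma span_S03_word: "S03.span (range S03_word) = UNIV"
proof -
  let ?V = "S03.span (range S03_word)"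
  have tilde: "tilde scale_S03 S03_gen x * s \<in> ?V" if "s \<in> ?V" for x s
    using that
  proof (induction rule: S03.span_induct_alt)
    case base
    then show ?case by (simp add: S03.span_zero)
  next
    case (step z s r)
    then obtain w where "s = S03_word w" by auto
    then have "tilde scale_S03 S03_gen x * s = S03_word (x # w)" by (simp add: S03_word_def)
    then have "tilde scale_S03 S03_gen x * s \<in> ?V" by (simp add: S03.span_base)
    with step show ?case
      by (simp add: distrib_left S03.scale_mult_right S03.span_add S03.span_scale del: tilde.simps)
  qed
  have gen: "S03_gen x * s \<in> ?V" if "s \<in> ?V" for x s
  proof -
    have "untilde (tilde scale_S03 S03_gen) x * s \<in> ?V"
      using tilde[OF that]
      by (cases x) (simp_all add: distrib_right left_diff_distrib S03.span_add S03.span_diff del: tilde.simps)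
    then show ?thesis by (simp only: S03.untilde_tilde)
  qed
  have word: "abs_S03 (prod_list (map free_gen w)) \<in> ?V" for w
  proof (induction w)
    case Nil
    have "S03_word [] \<in> ?V" by (simp add: S03.span_base)
    then show ?case by (simp add: S03_word_def one_S03_def)
  next
    case (Cons x w)
    then show ?case using gen[of _ x]
      by (simp add: S03_gen_def times_S03.abs_eq[symmetric])
  qed
  have "abs_S03 f \<in> ?V" for f
  proof (induction f rule: poly_mapping_induct)
    case (single w z)
    have "Poly_Mapping.single w z = scale_free z (prod_list (map free_gen w))"
      by (simp add: prod_list_free_gen scale_free_def mult_single)
    then show ?case
      using S03.span_scale[OF word[of w], of z] by (simp add: scale_S03.abs_eq)
  next
    case (sum f g)
    then show ?case by (simp add: plus_S03.abs_eq[symmetric] S03.span_add)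
  qed
  then have "s \<in> ?V" for s by (induction s rule: S03.abs_induct)
  then show ?thesis by blast
qed

text \<open>The words that are not normal contribute only zero to the spanning set.\<close>

lemma span_S03_normal_word: "S03.span (S03_word ` Collect normal_word) = UNIV"
proof -
  have "range S03_word \<subseteq> S03.span (S03_word ` Collect normal_word)"
    using S03_word_zero S03.span_zero S03.span_base by (metis (mono_tags, lifting) image_eqI image_subsetI mem_Collect_eq)
  then have "S03.span (range S03_word) \<subseteq> S03.span (S03_word ` Collect normal_word)"
    by (simp add: S03.span_minimal)
  then show ?thesis unfolding span_S03_word by blast
qed

lemma S03_basis:
  fixes mon :: "label \<Rightarrow> S03"
  defines "mon \<equiv> monomial (tilde scale_S03 S03_gen Ga) (tilde scale_S03 S03_gen Gb)
     (tilde scale_S03 S03_gen Gc) (tilde scale_S03 S03_gen Gd)"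
  shows "inj_on mon basis_labels" "mon ` basis_labels = range mon"
    "S03.independent (range mon)" "S03.span (range mon) = UNIV"
proof -
  \<comment> \<open>Through this factorization, injectivity and range of \<open>mon\<close> follow
    from those of \<open>letters\<close> and of \<open>S03_word\<close> on normal words.\<close>
  have mon: "mon = S03_word \<circ> letters"
    by (simp add: fun_eq_iff mon_def S03_word_def prod_list_letters del: tilde.simps)
  have range: "range mon = S03_word ` Collect normal_word"
    by (simp only: mon image_comp[symmetric] range_letters)
  show "inj_on mon basis_labels"
    unfolding mon using inj_on_letters inj_on_S03_word
    by (intro comp_inj_on) (simp_all add: letters_basis_labels)
  show "mon ` basis_labels = range mon"
    unfolding range by (simp only: mon image_comp[symmetric] letters_basis_labels)
  show "S03.independent (range mon)" "S03.span (range mon) = UNIV"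
    unfolding range by (rule independent_S03_word span_S03_normal_word)+
qed

theorem mainTheorem1:
  shows
    "(\<forall>(sc :: complex \<Rightarrow> 'a::ring_1 \<Rightarrow> 'a) a b c d. complex_algebra sc \<longrightarrow>
        ((RTT_lhs sc a b c d = RTT_rhs sc a b c d) \<longleftrightarrow>
           (b^2 + c^2 = 0 \<and> a^2 - d^2 = 0 \<and> c * d = b * a \<and> d * c = - (a * b) \<and>
            b * d = c * a \<and> d * b = - (a * c) \<and> d * a = a * d \<and> c * b = - (b * c))) \<and>
        (let a' = sc (1/2) (a + d); d' = sc (1/2) (a - d);
             b' = sc (1/2) (b + c); c' = sc (1/2) (b - c)
         in (RTT_lhs sc a b c d = RTT_rhs sc a b c d) \<longleftrightarrow>
              (b'^2 = 0 \<and> c'^2 = 0 \<and> a' * d' = 0 \<and> d' * a' = 0 \<and>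
               a' * b' = 0 \<and> b' * d' = 0 \<and> d' * c' = 0 \<and> c' * a' = 0)))
     \<and>
     (let a = free_gen Ga; b = free_gen Gb; c = free_gen Gc; d = free_gen Gd;
          a' = scale_free (1/2) (a + d); d' = scale_free (1/2) (a - d);
          b' = scale_free (1/2) (b + c); c' = scale_free (1/2) (b - c)
      in S03_ideal = two_sided_ideal hull
             {b^2 + c^2, a^2 - d^2, c * d - b * a, d * c + a * b,
              b * d - c * a, d * b + a * c, d * a - a * d, c * b + b * c} \<and>
         S03_ideal = two_sided_ideal hull
             {b'^2, c'^2, a' * d', d' * a', a' * b', b' * d', d' * c', c' * a'})
     \<and>
     (let a = S03_gen Ga; b = S03_gen Gb; c = S03_gen Gc; d = S03_gen Gd;
          a' = scale_S03 (1/2) (a + d); d' = scale_S03 (1/2) (a - d);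
          b' = scale_S03 (1/2) (b + c); c' = scale_S03 (1/2) (b - c);
          mon = monomial a' b' c' d'
      in inj_on mon basis_labels \<and>
         mon ` basis_labels = range mon \<and>
         S03.independent (range mon) \<and>
         S03.span (range mon) = UNIV)"
proof (intro conjI allI impI)
  fix sc :: "complex \<Rightarrow> 'a \<Rightarrow> 'a" and a b c d
  assume "complex_algebra sc"
  then interpret complex_algebra sc .
  show "(RTT_lhs sc a b c d = RTT_rhs sc a b c d) \<longleftrightarrow>
           (b^2 + c^2 = 0 \<and> a^2 - d^2 = 0 \<and> c * d = b * a \<and> d * c = - (a * b) \<and>
            b * d = c * a \<and> d * b = - (a * c) \<and> d * a = a * d \<and> c * b = - (b * c))"
    by (rule RTT_iff_quadratic)
  show "let a' = sc (1/2) (a + d); d' = sc (1/2) (a - d);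
             b' = sc (1/2) (b + c); c' = sc (1/2) (b - c)
         in (RTT_lhs sc a b c d = RTT_rhs sc a b c d) \<longleftrightarrow>
              (b'^2 = 0 \<and> c'^2 = 0 \<and> a' * d' = 0 \<and> d' * a' = 0 \<and>
               a' * b' = 0 \<and> b' * d' = 0 \<and> d' * c' = 0 \<and> c' * a' = 0)"
    unfolding Let_def by (rule RTT_iff_monomial)
next
  show "let a = free_gen Ga; b = free_gen Gb; c = free_gen Gc; d = free_gen Gd;
          a' = scale_free (1/2) (a + d); d' = scale_free (1/2) (a - d);
          b' = scale_free (1/2) (b + c); c' = scale_free (1/2) (b - c)
      in S03_ideal = two_sided_ideal hull
             {b^2 + c^2, a^2 - d^2, c * d - b * a, d * c + a * b,
              b * d - c * a, d * b + a * c, d * a - a * d, c * b + b * c} \<and>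
         S03_ideal = two_sided_ideal hull
             {b'^2, c'^2, a' * d', d' * a', a' * b', b' * d', d' * c', c' * a'}"
    using S03_ideal_quadratic S03_ideal_monomial
    unfolding Let_def free_alg.quadratic_rels_def free_alg.monomial_rels_def tilde.simps by (rule conjI)
next
  show "let a = S03_gen Ga; b = S03_gen Gb; c = S03_gen Gc; d = S03_gen Gd;
          a' = scale_S03 (1/2) (a + d); d' = scale_S03 (1/2) (a - d);
          b' = scale_S03 (1/2) (b + c); c' = scale_S03 (1/2) (b - c);
          mon = monomial a' b' c' d'
      in inj_on mon basis_labels \<and>
         mon ` basis_labels = range mon \<and>
         S03.independent (range mon) \<and>
         S03.span (range mon) = UNIV"
    using S03_basis unfolding Let_def tilde.simps by blast
qed

end
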